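(* Let $\mathcal{F}$ be a monotone class of graphs. Then the following are equivalent: (1) $\mathcal{F}$ is adjacency sketchable; (2) $\mathcal{F}$ admits a constant-size disjunctive adjacency labelling scheme, i.e. there are constants $s,k$ such that $\mathcal{F}$ admits an $(s,k)$-disjunctive adjacency labelling scheme; (3) $\mathcal{F}$ has bounded arboricity.
   Context: A class of graphs is a set of finite graphs closed under isomorphism; it is monotone if it is closed under taking (not necessarily induced) subgraphs. The arboricity of a graph is the minimum number of forests into which its edge set can be partitioned; a class has bounded arboricity if there is a constant $k$ such that every graph in the class has arboricity at most $k$. Adjacency sketch: a class $\mathcal{F}$ admits an adjacency sketch of size $s(n)$ if there is a function $D:\{0,1\}^*\times\{0,1\}^*\to\{0,1\}$ such that for every $G\in\mathcal{F}$ with $n$ vertices there is a probability distribution over functions $\mathsf{sk}:V(G)\to\{0,1\}^{s(n)}$ such that for all $x,y\in V(G)$, $\Pr[D(\mathsf{sk}(x),\mathsf{sk}(y))=1 \iff x,y \text{ are adjacent}]\ge 2/3$. $\mathcal{F}$ is adjacency sketchable if it admits an adjacency sketch whose size does not depend on $n$. Disjunctive labelling scheme: an $(s,k)$-disjunctive adjacency labelling scheme for $\mathcal{F}$ assigns (deterministically) to each vertex $x$ of each graph $G\in\mathcal{F}$ (with vertex set $[n]$) a label $(p(x)\mid q(x))$ with $p(x)\in\{0,1\}^s$ (the prefix) and $q(x)\in\mathbb{N}^k$ (the equality codes). The decoder, given the labels of $x$ and $y$, chooses, depending only on $p(x),p(y)$, a set $S\subseteq[k]\times[k]$ and outputs $1$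 iff $q(x)_i=q(y)_j$ for some $(i,j)\in S$ (a disjunction of entries of the matrix $Q_{x,y}(i,j)=\mathbf 1[q(x)_i=q(y)_j]$). It is required that the output equals $1$ iff $x$ and $y$ are adjacent in $G$, for all $G\in\mathcal{F}$ and all $x,y$. *)

theory Defs
  imports "HOL-Probability.Probability_Mass_Function" "HOL-Library.Disjoint_Sets" "HOL-Library.FuncSet"
begin

type_synonym 'a ugraph = "'a set \<times> 'a set set"

abbreviation verts :: "'a ugraph \<Rightarrow> 'a set" where "verts G \<equiv> fst G"

abbreviation edges :: "'a ugraph \<Rightarrow> 'a set set" where "edges G \<equiv> snd G"

definition finite_graph :: "'a ugraph \<Rightarrow> bool" where
  "finite_graph G \<longleftrightarrow> finite (verts G) \<and> (\<forall>e\<in>edges G. e \<subseteq> verts G \<and> card e = 2)"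

definition adjacent :: "'a ugraph \<Rightarrow> 'a \<Rightarrow> 'a \<Rightarrow> bool" where
  "adjacent G x y \<longleftrightarrow> {x, y} \<in> edges G"

definition subgraph :: "'a ugraph \<Rightarrow> 'a ugraph \<Rightarrow> bool" where
  "subgraph H G \<longleftrightarrow> finite_graph H \<and> verts H \<subseteq> verts G \<and> edges H \<subseteq> edges G"

definition isomorphic :: "'a ugraph \<Rightarrow> 'b ugraph \<Rightarrow> bool" where
  "isomorphic G H \<longleftrightarrow> (\<exists>f. bij_betw f (verts G) (verts H) \<and>
     (\<forall>x\<in>verts G. \<forall>y\<in>verts G. adjacent G x y \<longleftrightarrow> adjacent H (f x) (f y)))"

text \<open>Every finite graph is isomorphic to one whose vertices are natural numbers, so a class of
  graphs is determined by its members with vertices in \<^typ>\<open>nat\<close>.\<close>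

definition graph_class :: "nat ugraph set \<Rightarrow> bool" where
  "graph_class \<F> \<longleftrightarrow> (\<forall>G\<in>\<F>. finite_graph G) \<and>
     (\<forall>G\<in>\<F>. \<forall>H. finite_graph H \<and> isomorphic G H \<longrightarrow> H \<in> \<F>)"

definition monotone_class :: "nat ugraph set \<Rightarrow> bool" where
  "monotone_class \<F> \<longleftrightarrow> graph_class \<F> \<and> (\<forall>G\<in>\<F>. \<forall>H. subgraph H G \<longrightarrow> H \<in> \<F>)"

definition is_cycle :: "'a ugraph \<Rightarrow> 'a list \<Rightarrow> bool" where
  "is_cycle G c \<longleftrightarrow> 3 \<le> length c \<and> distinct c \<and> set c \<subseteq> verts G \<and>
     (\<forall>i<length c. adjacent G (c ! i) (c ! (Suc i mod length c)))"

definition forest :: "'a ugraph \<Rightarrow> bool" where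
  "forest G \<longleftrightarrow> finite_graph G \<and> (\<nexists>c. is_cycle G c)"

definition forest_partition :: "'a ugraph \<Rightarrow> 'a set set set \<Rightarrow> bool" where
  "forest_partition G P \<longleftrightarrow> partition_on (edges G) P \<and> (\<forall>A\<in>P. forest (verts G, A))"

definition arboricity :: "'a ugraph \<Rightarrow> nat" where
  "arboricity G = (LEAST k. \<exists>P. forest_partition G P \<and> card P = k)"

text \<open>The lemmas \<open>forest_partition_finite\<close> and \<open>forest_partition_exists\<close> show
  that the minimum is over a nonempty set of cardinalities of finite partitions.\<close>

lemma finite_edges:
  assumes "finite_graph G"
  shows "finite (edges G)"
proof (rule finite_subset)
  show "edges G \<subseteq> Pow (verts G)" using assms by (auto simp: finite_graph_def)
  show "finite (Pow (verts G))" using assms by (auto simp: finite_graph_def)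
qed

lemma forest_partition_finite:
  assumes "finite_graph G" "forest_partition G P"
  shows "finite P"
  using assms finite_edges finite_elements unfolding forest_partition_def by blast

lemma forest_partition_exists:
  assumes G: "finite_graph G"
  shows "\<exists>P. forest_partition G P"
proof (intro exI)
  have "forest (verts G, {e})" if e: "e \<in> edges G" for e
  proof -
    have "\<not> is_cycle (verts G, {e}) c" for c
    proof
      assume c: "is_cycle (verts G, {e}) c"
      then have l: "3 \<le> length c" and d: "distinct c"
        and a: "\<And>i. i < length c \<Longrightarrow> {c ! i, c ! (Suc i mod length c)} = e"
        by (auto simp: is_cycle_def adjacent_def)
      have "{c ! 0, c ! 1} = {c ! 1, c ! 2}" 
      proof -
        have "c ! (Suc 0 mod length c) = c ! 1" "c ! (Suc 1 mod length c) = c ! 2"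
          using l by (simp_all add: numeral_2_eq_2)
        then show ?thesis using a[of 0] a[of 1] l by fastforce
      qed
      then have "c ! 0 = c ! 2" by (auto simp: doubleton_eq_iff)
      moreover have "0 < length c" "2 < length c" using l by linarith+
      ultimately show False using nth_eq_iff_index_eq[OF d, of 0 2] by simp
    qed
    then show ?thesis using G e by (auto simp: forest_def finite_graph_def)
  qed
  then show "forest_partition G ((\<lambda>e. {e}) ` edges G)"
    by (auto simp: forest_partition_def partition_on_def disjoint_def)
qed

definition bounded_arboricity :: "nat ugraph set \<Rightarrow> bool" where
  "bounded_arboricity \<F> \<longleftrightarrow> (\<exists>k. \<forall>G\<in>\<F>. arboricity G \<le> k)"

definition bitstrings :: "nat \<Rightarrow> bool list set" where
  "bitstrings n = {w. length w = n}"

definition admits_adjacency_sketch :: "nat ugraph set \<Rightarrow> (nat \<Rightarrow> nat) \<Rightarrow> bool" where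
  "admits_adjacency_sketch \<F> s \<longleftrightarrow>
     (\<exists>D :: bool list \<Rightarrow> bool list \<Rightarrow> bool. \<forall>G\<in>\<F>.
        \<exists>\<mu> :: (nat \<Rightarrow> bool list) pmf.
          set_pmf \<mu> \<subseteq> verts G \<rightarrow>\<^sub>E bitstrings (s (card (verts G))) \<and>
          (\<forall>x\<in>verts G. \<forall>y\<in>verts G.
             measure_pmf.prob \<mu> {sk. D (sk x) (sk y) \<longleftrightarrow> adjacent G x y} \<ge> 2/3))"

definition adjacency_sketchable :: "nat ugraph set \<Rightarrow> bool" where
  "adjacency_sketchable \<F> \<longleftrightarrow> (\<exists>c. admits_adjacency_sketch \<F> (\<lambda>n. c))"

text \<open>\<^term>\<open>S a b\<close> is the set of index pairs that the decoder selects on seeing the prefixes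
  \<^term>\<open>a\<close> and \<^term>\<open>b\<close>; like the decoder of a sketch, it is fixed for the whole class. Entries of
  the equality codes are indexed from 0.\<close>

definition disjunctive_scheme :: "nat ugraph set \<Rightarrow> nat \<Rightarrow> nat \<Rightarrow> bool" where
  "disjunctive_scheme \<F> s k \<longleftrightarrow>
     (\<exists>S :: bool list \<Rightarrow> bool list \<Rightarrow> (nat \<times> nat) set.
        (\<forall>a b. S a b \<subseteq> {..<k} \<times> {..<k}) \<and>
        (\<forall>G\<in>\<F>. \<exists>(p :: nat \<Rightarrow> bool list) (q :: nat \<Rightarrow> nat list).
           (\<forall>x\<in>verts G. p x \<in> bitstrings s \<and> length (q x) = k) \<and>
           (\<forall>x\<in>verts G. \<forall>y\<in>verts G.
              (\<exists>(i, j)\<in>S (p x) (p y). q x ! i = q y ! j) \<longleftrightarrow> adjacent G x y)))"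

end

theory Submission imports Defs
begin

text \<open>A forest has a function sending each vertex to its parent, so a graph of arboricity at most \<open>k\<close>
  is described by the equalities between the name of one vertex and the \<open>k\<close> parents of the other: a
  disjunctive scheme with empty prefixes. Hashing the equality codes of a disjunctive scheme
  randomly gives a sketch. Conversely, suppose that a monotone class has sketches of \<open>c\<close> bits, and
  let \<open>G\<close> be a member with \<open>n\<close> vertices and \<open>m\<close> edges. All \<open>2\<^sup>m\<close> spanning subgraphs of \<open>G\<close> are members,
  and by averaging each agrees with the decoder on \<open>2/3\<close> of the edges of \<open>G\<close> for one of the
  \<open>2^(c * n)\<close> deterministic sketches. A Hamming ball of radius \<open>m/3\<close> has at most
  \<open>((27/4)^(1/3))^m\<close> points, and \<open>(27/4)^(1/3) < 2\<close>, so \<open>m = O(c * n)\<close>. This bound holds for all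
  subgraphs of \<open>G\<close>, so \<open>G\<close> has bounded degeneracy and hence bounded arboricity.\<close>

section \<open>Forests and disjunctive schemes\<close>

text \<open>Edges are sets, so \<open>card (incident G v)\<close> is the degree of \<open>v\<close>
  and colours of edges can be compared directly.\<close>

definition incident :: "'a ugraph \<Rightarrow> 'a \<Rightarrow> 'a set set" where
  "incident G v = {e \<in> edges G. v \<in> e}"

definition delete_vertex :: "'a ugraph \<Rightarrow> 'a \<Rightarrow> 'a ugraph" where
  "delete_vertex G v = (verts G - {v}, edges G - incident G v)"

lemma adjacent_commute: "adjacent G x y \<longleftrightarrow> adjacent G y x"
  by (simp add: adjacent_def insert_commute)

lemma adjacent_irrefl: "finite_graph G \<Longrightarrow> \<not> adjacent G x x"
  by (auto simp: adjacent_def finite_graph_def)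

lemma adjacent_verts: "finite_graph G \<Longrightarrow> adjacent G x y \<Longrightarrow> x \<in> verts G \<and> y \<in> verts G"
  by (auto simp: adjacent_def finite_graph_def)

lemma finite_incident: "finite_graph G \<Longrightarrow> finite (incident G v)"
  by (simp add: incident_def finite_edges)

lemma finite_graph_delete_vertex: "finite_graph G \<Longrightarrow> finite_graph (delete_vertex G v)"
  by (auto simp: finite_graph_def delete_vertex_def incident_def)

lemma subgraph_delete_vertex: "finite_graph G \<Longrightarrow> subgraph (delete_vertex G v) G"
  unfolding subgraph_def using finite_graph_delete_vertex[of G v] by (auto simp: delete_vertex_def)

lemma subgraph_trans: "subgraph H G \<Longrightarrow> subgraph G K \<Longrightarrow> subgraph H K"
  by (auto simp: subgraph_def)

lemma is_cycle_mono:
  "is_cycle H c \<Longrightarrow> verts H \<subseteq> verts G \<Longrightarrow> edges H \<subseteq> edges G \<Longrightarrow> is_cycle G c"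
  unfolding is_cycle_def adjacent_def by blast

lemma forest_subgraph: "forest G \<Longrightarrow> subgraph H G \<Longrightarrow> forest H"
  unfolding forest_def subgraph_def using is_cycle_mono by blast

lemma incident_edgeE:
  assumes "finite_graph G" "e \<in> incident G v"
  obtains w where "e = {v, w}" "adjacent G v w" "w \<noteq> v"
proof -
  have "card e = 2" "v \<in> e" "e \<in> edges G"
    using assms by (auto simp: finite_graph_def incident_def)
  then obtain a b where "e = {a, b}" "a \<noteq> b" by (auto simp: card_2_iff)
  with \<open>v \<in> e\<close> obtain w where "e = {v, w}" "w \<noteq> v" by auto
  with \<open>e \<in> edges G\<close> show ?thesis using that[of w] by (simp add: adjacent_def)
qed

lemma degree_ge_2_other_neighbour:
  assumes G: "finite_graph G" and d: "card (incident G v) \<ge> 2"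
  obtains w where "adjacent G v w" "w \<noteq> u"
proof -
  obtain e1 e2 where e: "e1 \<in> incident G v" "e2 \<in> incident G v" "e1 \<noteq> e2"
    using d by (metis card_le_Suc0_iff_eq finite_incident[OF G] not_less_eq_eq numeral_2_eq_2)
  obtain w1 where "e1 = {v, w1}" "adjacent G v w1" using incident_edgeE[OF G e(1)] by blast
  moreover obtain w2 where "e2 = {v, w2}" "adjacent G v w2" using incident_edgeE[OF G e(2)] by blast
  ultimately show ?thesis using e(3) that by metis
qed

text \<open>The first vertex of a longest path has all its neighbours on the path, and the second of
  these closes a cycle.\<close>

lemma min_degree_2_has_cycle:
  assumes G: "finite_graph G" and ne: "verts G \<noteq> {}"
    and deg: "\<And>v. v \<in> verts G \<Longrightarrow> card (incident G v) \<ge> 2"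
  shows "\<exists>c. is_cycle G c"
proof -
  define path where "path c \<longleftrightarrow> c \<noteq> [] \<and> distinct c \<and> set c \<subseteq> verts G \<and>
    (\<forall>i. Suc i < length c \<longrightarrow> adjacent G (c ! i) (c ! Suc i))" for c
  have fin: "finite (verts G)" using G by (simp add: finite_graph_def)
  obtain v where "v \<in> verts G" using ne by blast
  then have "path [v]" by (simp add: path_def)
  moreover have "\<forall>c. path c \<longrightarrow> length c < Suc (card (verts G))"
    by (metis path_def card_mono distinct_card fin le_imp_less_Suc)
  ultimately obtain c where c: "path c" and longest: "\<And>c'. path c' \<Longrightarrow> length c' \<le> length c"
    using ex_has_greatest_nat[of path "[v]" length "Suc (card (verts G))"] by blast
  obtain x xs where cx: "c = x # xs" using c by (cases c) (auto simp: path_def)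
  have closed: "w \<in> set c" if "adjacent G x w" for w
  proof (rule ccontr)
    assume "w \<notin> set c"
    moreover have "w \<in> verts G" using adjacent_verts[OF G that] by simp
    moreover have "adjacent G ((w # c) ! i) ((w # c) ! Suc i)" if "Suc i < length (w # c)" for i
      using c that \<open>adjacent G x w\<close> unfolding path_def
      by (cases i) (auto simp: cx adjacent_commute[of G w x])
    ultimately have "path (w # c)" using c by (auto simp: path_def)
    then show False using longest[of "w # c"] by simp
  qed
  have xV: "x \<in> verts G" using c cx by (auto simp: path_def)
  \<comment> \<open>If the path has a single vertex, \<open>c ! 1\<close> is an unspecified value.
    This is harmless: only \<open>w \<noteq> c ! 1\<close> is used, and it excludes
    \<open>j = 1\<close> below.\<close>
  obtain w where w: "adjacent G x w" "w \<noteq> c ! 1"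
    using degree_ge_2_other_neighbour[OF G deg[OF xV]] by blast
  obtain j where j: "j < length c" "c ! j = w" using closed[OF w(1)] by (auto simp: in_set_conv_nth)
  have "j \<noteq> 0" using j w(1) adjacent_irrefl[OF G] cx by (cases j) auto
  moreover have "j \<noteq> 1" using j w by auto
  ultimately have j2: "j \<ge> 2" by simp
  have "is_cycle G (take (Suc j) c)"
    unfolding is_cycle_def
  proof (intro conjI allI impI)
    show "3 \<le> length (take (Suc j) c)" using j j2 by simp
    show "distinct (take (Suc j) c)" "set (take (Suc j) c) \<subseteq> verts G"
      using c set_take_subset[of "Suc j" c] by (auto simp: path_def)
    fix i assume i: "i < length (take (Suc j) c)"
    have l: "length (take (Suc j) c) = Suc j" using j by simp
    show "adjacent G (take (Suc j) c ! i) (take (Suc j) c ! (Suc i mod length (take (Suc j) c)))"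
    proof (cases "i = j")
      case True
      moreover have "take (Suc j) c ! j = w" "take (Suc j) c ! 0 = x"
        using j cx by (simp_all only: nth_take lessI zero_less_Suc nth_Cons_0)
      ultimately show ?thesis using l w(1) by (simp add: adjacent_commute)
    next
      case False
      then have "Suc i < Suc j" using i l by simp
      then show ?thesis using l j c by (simp add: path_def)
    qed
  qed
  then show ?thesis by blast
qed

lemma forest_has_leaf:
  assumes "forest G" "verts G \<noteq> {}"
  obtains v where "v \<in> verts G" "card (incident G v) \<le> 1"
proof -
  have "\<not> (\<forall>v\<in>verts G. card (incident G v) \<ge> 2)"
    using min_degree_2_has_cycle[of G] assms by (auto simp: forest_def)
  then show ?thesis using that by (auto simp: not_le)
qed

text \<open>Leaves are removed one at a time. When a leaf is put back, its only neighbour, if there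
  is one, becomes its parent, and all other parents stay as they were.\<close>

lemma forest_parent_function:
  assumes "forest G"
  shows "\<exists>f :: 'a \<Rightarrow> 'a option. \<forall>x y. adjacent G x y \<longleftrightarrow> f x = Some y \<or> f y = Some x"
  using assms
proof (induction "card (verts G)" arbitrary: G)
  case 0
  then have "finite_graph G" "verts G = {}" by (auto simp: forest_def finite_graph_def)
  then have "\<not> adjacent G x y" for x y using adjacent_verts by fastforce
  then show ?case by (intro exI[of _ "\<lambda>_. None"]) simp
next
  case (Suc n)
  have G: "finite_graph G" using Suc.prems by (simp add: forest_def)
  have "verts G \<noteq> {}" using Suc.hyps(2) by auto
  then obtain v where v: "v \<in> verts G" "card (incident G v) \<le> 1"
    using forest_has_leaf[OF Suc.prems] by blast
  let ?H = "delete_vertex G v"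
  have "forest ?H" using forest_subgraph[OF Suc.prems subgraph_delete_vertex[OF G]] .
  moreover have "n = card (verts ?H)"
    using Suc.hyps(2) v(1) G by (simp add: delete_vertex_def finite_graph_def)
  ultimately obtain f :: "'a \<Rightarrow> 'a option"
    where f: "\<And>x y. adjacent ?H x y \<longleftrightarrow> f x = Some y \<or> f y = Some x"
    using Suc.hyps(1)[of ?H] by blast
  have adj: "adjacent ?H x y \<longleftrightarrow> adjacent G x y \<and> x \<noteq> v \<and> y \<noteq> v" for x y
    by (auto simp: adjacent_def delete_vertex_def incident_def)
  have nbr: "w = u" if "adjacent G v w" "adjacent G v u" for w u
  proof -
    have "{v, w} \<in> incident G v" "{v, u} \<in> incident G v"
      using that by (auto simp: adjacent_def incident_def)
    then have "{v, w} = {v, u}"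
      using v(2) card_le_Suc0_iff_eq[OF finite_incident[OF G]] by (metis One_nat_def)
    then show ?thesis by (auto simp: doubleton_eq_iff)
  qed
  define g where "g = f(v := if \<exists>w. adjacent G v w then Some (SOME w. adjacent G v w) else None)"
  have gv: "g v = Some w \<longleftrightarrow> adjacent G v w" for w
    using nbr someI[of "adjacent G v"] by (auto simp: g_def)
  have gx: "g x = f x" if "x \<noteq> v" for x using that by (simp add: g_def)
  \<comment> \<open>No vertex has parent \<open>v\<close> in the smaller forest, so every edge at
    \<open>v\<close> comes from the new value \<open>g v\<close> alone.\<close>
  have fv: "f x \<noteq> Some v" for x using f[of x v] adj by auto
  have "adjacent G x y \<longleftrightarrow> g x = Some y \<or> g y = Some x" for x y
    using f[of x y] adj[of x y] fv gv gx adjacent_commute[of G] adjacent_irrefl[OF G]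
    by (cases "x = v"; cases "y = v") auto
  then show ?case by blast
qed

lemma forest_partition_of_arboricity:
  assumes "finite_graph G"
  shows "\<exists>P. forest_partition G P \<and> card P = arboricity G"
  unfolding arboricity_def using LeastI_ex[of "\<lambda>k. \<exists>P. forest_partition G P \<and> card P = k"]
    forest_partition_exists[OF assms] by blast

text \<open>Each forest of an optimal partition contributes one parent function; an edge is
  witnessed in the forest that contains it.\<close>

lemma arboricity_parent_functions:
  assumes G: "finite_graph G" and k: "arboricity G \<le> k"
  shows "\<exists>f :: nat \<Rightarrow> 'a \<Rightarrow> 'a option.
    \<forall>x y. adjacent G x y \<longleftrightarrow> (\<exists>i<k. f i x = Some y \<or> f i y = Some x)"
proof -
  obtain P where P: "forest_partition G P" "card P = arboricity G"
    using forest_partition_of_arboricity[OF G] by blast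
  have "\<forall>A\<in>P. \<exists>f :: 'a \<Rightarrow> 'a option. \<forall>x y. {x, y} \<in> A \<longleftrightarrow> f x = Some y \<or> f y = Some x"
    using P(1) forest_parent_function by (fastforce simp: forest_partition_def adjacent_def)
  then obtain f :: "'a set set \<Rightarrow> 'a \<Rightarrow> 'a option"
    where f: "\<And>A x y. A \<in> P \<Longrightarrow> {x, y} \<in> A \<longleftrightarrow> f A x = Some y \<or> f A y = Some x"
    by metis
  obtain h where h: "bij_betw h {0..<card P} P"
    using ex_bij_betw_nat_finite[OF forest_partition_finite[OF G P(1)]] by blast
  \<comment> \<open>The indices from \<open>card P\<close> up to \<open>k\<close> are filled with
    functions that give no parents and so contribute no edges.\<close>
  define g where "g i = (if i < card P then f (h i) else (\<lambda>_. None))" for i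
  have UP: "\<Union>P = edges G" using P(1) by (simp add: forest_partition_def partition_on_def)
  have hP: "h ` {0..<card P} = P" using h by (simp add: bij_betw_def)
  have "adjacent G x y \<longleftrightarrow> (\<exists>i<k. g i x = Some y \<or> g i y = Some x)" for x y
  proof -
    have "adjacent G x y \<longleftrightarrow> (\<exists>A\<in>P. {x, y} \<in> A)" by (auto simp: adjacent_def UP[symmetric])
    also have "\<dots> \<longleftrightarrow> (\<exists>i\<in>{0..<card P}. {x, y} \<in> h i)" by (subst hP[symmetric]) simp
    also have "\<dots> \<longleftrightarrow> (\<exists>i\<in>{0..<card P}. g i x = Some y \<or> g i y = Some x)"
    proof (intro bex_cong refl)
      fix i assume i: "i \<in> {0..<card P}"
      then have "h i \<in> P" using hP by blast
      then show "{x, y} \<in> h i \<longleftrightarrow> g i x = Some y \<or> g i y = Some x" using f i by (simp add: g_def)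
    qed
    also have "\<dots> \<longleftrightarrow> (\<exists>i<k. g i x = Some y \<or> g i y = Some x)"
      using k P(2) by (force simp: g_def split: if_splits)
    finally show ?thesis .
  qed
  then show ?thesis by blast
qed

text \<open>Code 0 is the name of the vertex and codes 1 to \<open>k\<close> are its parents.
  Comparing the name on either side with the parents on the other side tests both directions of the
  parent relation.\<close>

lemma disjunctive_scheme_of_bounded_arboricity:
  assumes fin: "\<And>G. G \<in> \<F> \<Longrightarrow> finite_graph G" and k: "\<And>G. G \<in> \<F> \<Longrightarrow> arboricity G \<le> k"
  shows "disjunctive_scheme \<F> 0 (Suc k)"
  unfolding disjunctive_scheme_def
proof (intro exI[of _ "\<lambda>_ _. {0} \<times> {1..k} \<union> {1..k} \<times> {0}"] conjI ballI)
  fix G assume G: "G \<in> \<F>"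
  obtain f :: "nat \<Rightarrow> nat \<Rightarrow> nat option"
    where f: "\<And>x y. adjacent G x y \<longleftrightarrow> (\<exists>i<k. f i x = Some y \<or> f i y = Some x)"
    using arboricity_parent_functions[OF fin[OF G] k[OF G]] by metis
  \<comment> \<open>Names are shifted by one so that 0 can stand for a missing parent and never
    matches a vertex.\<close>
  define code where "code z = (case z of None \<Rightarrow> 0 | Some y \<Rightarrow> Suc y)" for z :: "nat option"
  define q where "q x = Suc x # map (\<lambda>i. code (f i x)) [0..<k]" for x
  have q: "q x ! 0 = Suc x" "i < k \<Longrightarrow> q x ! Suc i = code (f i x)" for x i
    by (simp_all add: q_def)
  have code: "code z = Suc y \<longleftrightarrow> z = Some y" "Suc y = code z \<longleftrightarrow> z = Some y" for z y
    by (auto simp: code_def split: option.splits)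
  have "(\<exists>(i, j)\<in>{0} \<times> {1..k} \<union> {1..k} \<times> {0}. q x ! i = q y ! j) \<longleftrightarrow> adjacent G x y" for x y
  proof -
    have "(\<exists>(i, j)\<in>{0} \<times> {1..k} \<union> {1..k} \<times> {0}. q x ! i = q y ! j) \<longleftrightarrow>
      (\<exists>j\<in>{1..k}. q x ! 0 = q y ! j \<or> q x ! j = q y ! 0)" by auto
    also have "\<dots> \<longleftrightarrow> (\<exists>i<k. q x ! 0 = q y ! Suc i \<or> q x ! Suc i = q y ! 0)"
      unfolding image_Suc_lessThan[symmetric] by blast
    also have "\<dots> \<longleftrightarrow> adjacent G x y" unfolding f by (auto simp: q code)
    finally show ?thesis .
  qed
  moreover have "length (q x) = Suc k" for x by (simp add: q_def)
  ultimately show "\<exists>(p :: nat \<Rightarrow> bool list) (q :: nat \<Rightarrow> nat list).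
    (\<forall>x\<in>verts G. p x \<in> bitstrings 0 \<and> length (q x) = Suc k) \<and>
    (\<forall>x\<in>verts G. \<forall>y\<in>verts G. (\<exists>(i, j)\<in>{0} \<times> {1..k} \<union> {1..k} \<times> {0}. q x ! i = q y ! j) \<longleftrightarrow>
      adjacent G x y)"
    by (intro exI[of _ "\<lambda>_. [] :: bool list"] exI[of _ q]) (simp add: bitstrings_def)
qed auto

section \<open>Hashing the equality codes\<close>

lemma card_bitstrings: "card (bitstrings n) = 2 ^ n" and finite_bitstrings: "finite (bitstrings n)"
  using card_lists_length_eq[of "UNIV :: bool set" n] finite_lists_length_eq[of "UNIV :: bool set" n]
  by (simp_all add: bitstrings_def)

lemma bitstrings_nonempty: "bitstrings n \<noteq> {}"
  using card_bitstrings[of n] by fastforce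

text \<open>A function with \<open>h a = h b\<close> is determined by its restriction to
  \<open>A - {a}\<close>, so at most \<open>card B ^ (card A - 1)\<close> of the
  \<open>card B ^ card A\<close> functions collide.\<close>

lemma collision_probability:
  assumes "finite A" "finite B" "B \<noteq> {}" "a \<in> A" "b \<in> A" "a \<noteq> b"
  shows "measure_pmf.prob (pmf_of_set (A \<rightarrow>\<^sub>E B)) {h. h a = h b} \<le> 1 / card B"
proof -
  let ?F = "A \<rightarrow>\<^sub>E B" and ?A' = "A - {a}"
  have fin: "finite ?F" "finite (?A' \<rightarrow>\<^sub>E B)" using assms by (auto intro: finite_PiE)
  have ne: "?F \<noteq> {}" using assms by (simp add: PiE_eq_empty_iff)
  have "inj_on (\<lambda>h. restrict h ?A') (?F \<inter> {h. h a = h b})"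
  proof (rule inj_onI)
    fix g h assume gh: "g \<in> ?F \<inter> {h. h a = h b}" "h \<in> ?F \<inter> {h. h a = h b}"
      and eq: "restrict g ?A' = restrict h ?A'"
    have "g x = h x" if "x \<in> ?A'" for x using fun_cong[OF eq, of x] that by simp
    moreover from this have "g a = h a" using assms gh by simp
    ultimately have "g x = h x" if "x \<in> A" for x using that by blast
    then show "g = h" using gh by (intro PiE_ext[of g A "\<lambda>_. B" h]) auto
  qed
  moreover have "(\<lambda>h. restrict h ?A') ` (?F \<inter> {h. h a = h b}) \<subseteq> ?A' \<rightarrow>\<^sub>E B"
    by (intro image_subsetI restrict_PiE_iff[THEN iffD2]) auto
  ultimately have "card (?F \<inter> {h. h a = h b}) \<le> card B ^ card ?A'"
    using card_inj_on_le[OF _ _ fin(2)] assms by (simp add: card_funcsetE)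
  moreover have "card A = Suc (card ?A')" using assms by (simp only: card_Suc_Diff1)
  then have "card ?F = card B * card B ^ card ?A'"
    using assms by (simp only: card_funcsetE power_Suc)
  moreover have "card B > 0" using assms by (simp add: card_gt_0_iff)
  ultimately show ?thesis
    by (simp add: measure_pmf_of_set[OF ne fin(1)] field_simps flip: of_nat_power of_nat_mult)
qed

text \<open>This lets the decoder cut the individual hashes back out of a sketch.\<close>

lemma take_drop_concat_uniform:
  assumes "\<And>l. l \<in> set ls \<Longrightarrow> length l = t" "i < length ls"
  shows "take t (drop (i * t) (concat ls)) = ls ! i"
  using assms
proof (induction ls arbitrary: i)
  case (Cons l ls)
  then show ?case by (cases i) auto
qed simp

lemma length_concat_uniform:
  assumes "\<And>l. l \<in> set ls \<Longrightarrow> length l = t"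
  shows "length (concat ls) = length ls * t"
  using assms by (induction ls) auto

text \<open>The equality codes are replaced by random hashes of \<open>t = 3k\<^sup>2\<close> bits, written one after
  another behind the prefix. Equal codes stay equal, so the only errors are collisions among at most
  \<open>k\<^sup>2\<close> pairs of distinct codes, each of probability \<open>1 / 2\<^sup>t\<close>.\<close>

lemma sketchable_of_disjunctive_scheme:
  assumes fin: "\<And>G. G \<in> \<F> \<Longrightarrow> finite_graph G" and scheme: "disjunctive_scheme \<F> s k"
  shows "adjacency_sketchable \<F>"
proof -
  obtain S :: "bool list \<Rightarrow> bool list \<Rightarrow> (nat \<times> nat) set"
    where Sk: "\<And>a b. S a b \<subseteq> {..<k} \<times> {..<k}"
      and S: "\<And>G. G \<in> \<F> \<Longrightarrow> \<exists>(p :: nat \<Rightarrow> bool list) (q :: nat \<Rightarrow> nat list).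
           (\<forall>x\<in>verts G. p x \<in> bitstrings s \<and> length (q x) = k) \<and>
           (\<forall>x\<in>verts G. \<forall>y\<in>verts G.
              (\<exists>(i, j)\<in>S (p x) (p y). q x ! i = q y ! j) \<longleftrightarrow> adjacent G x y)"
    using scheme unfolding disjunctive_scheme_def by blast
  define t where "t = 3 * k\<^sup>2"
  define block where "block u i = take t (drop (i * t) (drop s u))" for u :: "bool list" and i
  define D where "D u v \<longleftrightarrow> (\<exists>(i, j)\<in>S (take s u) (take s v). block u i = block v j)" for u v
  have "\<exists>\<mu> :: (nat \<Rightarrow> bool list) pmf.
          set_pmf \<mu> \<subseteq> verts G \<rightarrow>\<^sub>E bitstrings (s + k * t) \<and>
          (\<forall>x\<in>verts G. \<forall>y\<in>verts G.
             measure_pmf.prob \<mu> {sk. D (sk x) (sk y) \<longleftrightarrow> adjacent G x y} \<ge> 2/3)"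
    if GF: "G \<in> \<F>" for G
  proof -
    obtain p :: "nat \<Rightarrow> bool list" and q :: "nat \<Rightarrow> nat list"
      where p: "\<And>x. x \<in> verts G \<Longrightarrow> length (p x) = s" and q: "\<And>x. x \<in> verts G \<Longrightarrow> length (q x) = k"
        and pq: "\<And>x y. x \<in> verts G \<Longrightarrow> y \<in> verts G \<Longrightarrow>
              (\<exists>(i, j)\<in>S (p x) (p y). q x ! i = q y ! j) \<longleftrightarrow> adjacent G x y"
      using S[OF GF] unfolding bitstrings_def by blast
    \<comment> \<open>Only the finitely many codes that occur in \<open>G\<close> are hashed, so a
      uniformly random hash function exists.\<close>
    define A where "A = (\<Union>x\<in>verts G. set (q x))"
    have finA: "finite A" using fin[OF GF] by (simp add: A_def finite_graph_def)
    let ?H = "A \<rightarrow>\<^sub>E bitstrings t"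
    define \<nu> where "\<nu> = pmf_of_set ?H"
    define sketch where "sketch h = restrict (\<lambda>x. p x @ concat (map h (q x))) (verts G)"
      for h :: "nat \<Rightarrow> bool list"
    have set\<nu>: "set_pmf \<nu> = ?H"
      unfolding \<nu>_def using finA finite_bitstrings bitstrings_nonempty
      by (intro set_pmf_of_set) (auto simp: PiE_eq_empty_iff intro: finite_PiE)
    have hash: "length l = t" if h: "h \<in> ?H" and l: "x \<in> verts G" "l \<in> set (map h (q x))" for h x l
    proof -
      obtain c where "l = h c" "c \<in> A" using l unfolding A_def set_map by blast
      then show ?thesis using PiE_mem[OF h, of c] by (simp add: bitstrings_def)
    qed
    have block: "block (sketch h x) i = h (q x ! i)" if "h \<in> ?H" "x \<in> verts G" "i < k" for h x i
      using that p q take_drop_concat_uniform[of "map h (q x)" t i] hash[OF that(1,2)]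
      by (simp add: block_def sketch_def)
    have pre: "take s (sketch h x) = p x" if "x \<in> verts G" for h x
      using that p by (simp add: sketch_def)
    have "sketch h \<in> verts G \<rightarrow>\<^sub>E bitstrings (s + k * t)" if "h \<in> ?H" for h
      using length_concat_uniform[of "map h (q _)" t] hash[OF that] p q by (auto simp: sketch_def bitstrings_def)
    then have supp: "set_pmf (map_pmf sketch \<nu>) \<subseteq> verts G \<rightarrow>\<^sub>E bitstrings (s + k * t)"
      by (auto simp: set\<nu>)
    have "measure_pmf.prob (map_pmf sketch \<nu>) {sk. D (sk x) (sk y) \<longleftrightarrow> adjacent G x y} \<ge> 2/3"
      if x: "x \<in> verts G" and y: "y \<in> verts G" for x y
    proof -
      let ?good = "{h. D (sketch h x) (sketch h y) \<longleftrightarrow> adjacent G x y}"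
      \<comment> \<open>A selected pair with equal codes matches under every hash, so the decoder
        can err only if some pair in \<open>J\<close> collides.\<close>
      define J where "J = {(i, j)\<in>S (p x) (p y). q x ! i \<noteq> q y ! j}"
      have Jk: "J \<subseteq> {..<k} \<times> {..<k}" using Sk by (auto simp: J_def)
      then have finJ: "finite J" by (rule finite_subset) simp
      have "card J \<le> k\<^sup>2" using card_mono[OF _ Jk] by (simp add: power2_eq_square)
      have D: "D (sketch h x) (sketch h y) \<longleftrightarrow> (\<exists>(i, j)\<in>S (p x) (p y). h (q x ! i) = h (q y ! j))"
        if h: "h \<in> ?H" for h
        unfolding D_def pre[OF x] pre[OF y] using Sk[of "p x" "p y"] block[OF h] x y
        by (intro bex_cong) auto
      have bad: "h \<in> (\<Union>(i, j)\<in>J. {h. h (q x ! i) = h (q y ! j)})" if h: "h \<in> ?H" "h \<notin> ?good" for h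
        using h(2) unfolding mem_Collect_eq D[OF h(1)] pq[OF x y, symmetric] J_def by force
      have "measure_pmf.prob \<nu> (- ?good)
          \<le> measure_pmf.prob \<nu> (\<Union>(i, j)\<in>J. {h. h (q x ! i) = h (q y ! j)})"
        using bad by (intro measure_pmf.finite_measure_mono_AE) (auto simp: AE_measure_pmf_iff set\<nu>)
      also have "\<dots> \<le> (\<Sum>(i, j)\<in>J. measure_pmf.prob \<nu> {h. h (q x ! i) = h (q y ! j)})"
        using measure_pmf.finite_measure_subadditive_finite[OF finJ, of
            "\<lambda>(i, j). {h. h (q x ! i) = h (q y ! j)}" \<nu>]
        by (simp add: case_prod_unfold)
      also have "\<dots> \<le> (\<Sum>(i, j)\<in>J. 1 / 2 ^ t)"
      proof (intro sum_mono, clarify)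
        fix i j assume ij: "(i, j) \<in> J"
        then have "i < k" "j < k" "q x ! i \<noteq> q y ! j" using Jk by (auto simp: J_def)
        then show "measure_pmf.prob \<nu> {h. h (q x ! i) = h (q y ! j)} \<le> 1 / 2 ^ t"
          using collision_probability[OF finA finite_bitstrings bitstrings_nonempty,
              of "q x ! i" "q y ! j" t] q x y
          by (force simp: \<nu>_def card_bitstrings A_def)
      qed
      also have "\<dots> = card J / 2 ^ t" by simp
      also have "\<dots> \<le> 1/3"
      proof -
        \<comment> \<open>The factor 3 in \<open>t\<close> turns \<open>t < 2 ^ t\<close> into a
          total error of at most 1/3.\<close>
        have "3 * card J \<le> t" using \<open>card J \<le> k\<^sup>2\<close> by (simp add: t_def)
        then have "3 * card J \<le> 2 ^ t" using less_exp[of t] by linarith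
        then have "real (3 * card J) \<le> 2 ^ t" by (metis of_nat_le_iff of_nat_numeral of_nat_power)
        then show ?thesis by (simp add: field_simps)
      qed
      finally have "measure_pmf.prob \<nu> ?good \<ge> 2/3"
        using measure_pmf.prob_compl[of ?good \<nu>] by (simp add: Compl_eq_Diff_UNIV)
      then show ?thesis by (simp add: vimage_def)
    qed
    with supp show ?thesis by blast
  qed
  then show ?thesis unfolding adjacency_sketchable_def admits_adjacency_sketch_def by blast
qed

section \<open>Sketchable graphs have few edges\<close>

text \<open>Chernoff's argument: weight a subset at distance \<open>d\<close> from \<open>A\<close> by \<open>(1/2)^d\<close>; the total weight is
  \<open>(3/2)^card E\<close>. The cube makes the exponent \<open>card E / 3\<close> integral.\<close>

lemma card_hamming_ball_third:
  assumes E: "finite E" and A: "A \<subseteq> E"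
  shows "real (card {H \<in> Pow E. 3 * card (sym_diff H A) \<le> card E}) ^ 3 \<le> (27/4) ^ card E"
proof -
  define m where "m = card E"
  define N where "N = {H \<in> Pow E. 3 * card (sym_diff H A) \<le> m}"
  \<comment> \<open>Symmetric difference with \<open>A\<close> is its own inverse and turns distance
    from \<open>A\<close> into size, so the total weight does not depend on
    \<open>A\<close>.\<close>
  have "bij_betw (\<lambda>H. sym_diff H A) (Pow E) (Pow E)"
    using A by (intro bij_betwI[of _ _ _ "\<lambda>H. sym_diff H A"]) auto
  then have "(\<Sum>H\<in>Pow E. (1/2::real) ^ card (sym_diff H A)) = (\<Sum>H\<in>Pow E. (1/2) ^ card H)"
    by (rule sum.reindex_bij_betw)
  \<comment> \<open>The sum over subsets is the expansion of a product of \<open>m\<close> factors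
    1/2 + 1.\<close>
  also have "\<dots> = (3/2) ^ m"
    using prod_add[OF E, of "\<lambda>_. 1/2::real" "\<lambda>_. 1"] by (simp add: m_def)
  finally have total: "(\<Sum>H\<in>Pow E. (1/2::real) ^ card (sym_diff H A)) = (3/2) ^ m" .
  have "real (card N) * (1/2) ^ (m div 3) = (\<Sum>H\<in>N. (1/2) ^ (m div 3))" by simp
  also have "\<dots> \<le> (\<Sum>H\<in>N. (1/2) ^ card (sym_diff H A))"
    by (intro sum_mono power_decreasing) (auto simp: N_def)
  also have "\<dots> \<le> (3/2) ^ m"
    unfolding total[symmetric] using E by (intro sum_mono2) (auto simp: N_def)
  finally have "real (card N) \<le> (3/2) ^ m * 2 ^ (m div 3)"
    by (simp add: field_simps)
  then have "real (card N) ^ 3 \<le> ((3/2) ^ m * 2 ^ (m div 3)) ^ 3"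
    by (intro power_mono) auto
  also have "\<dots> = ((3/2) ^ 3) ^ m * 2 ^ (3 * (m div 3))"
    by (simp add: power_mult_distrib mult.commute flip: power_mult)
  also have "\<dots> \<le> ((3/2) ^ 3) ^ m * 2 ^ m"
    by (intro mult_left_mono power_increasing) auto
  also have "\<dots> = (27/4) ^ m"
    by (simp add: power3_eq_cube flip: power_mult_distrib)
  finally show ?thesis by (simp add: N_def m_def)
qed

text \<open>The expected number of successes is at least two thirds of \<open>card E\<close>, so
  some outcome in the support does as well as that.\<close>

lemma outcome_with_few_failures:
  assumes fin: "finite (set_pmf \<mu>)" and E: "finite E"
    and prob: "\<And>e. e \<in> E \<Longrightarrow> measure_pmf.prob \<mu> {w. R w e} \<ge> 2/3"
  shows "\<exists>w\<in>set_pmf \<mu>. 3 * card {e\<in>E. \<not> R w e} \<le> card E"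
proof (rule ccontr)
  assume neg: "\<not> ?thesis"
  define X where "X w = (\<Sum>e\<in>E. indicator {w. R w e} w :: real)" for w
  have int: "integrable (measure_pmf \<mu>) f" for f :: "_ \<Rightarrow> real"
    using fin by (rule integrable_measure_pmf_finite)
  have X: "X w = card {e\<in>E. R w e}" for w
    unfolding X_def using E by (simp add: indicator_def sum.If_cases Int_def)
  \<comment> \<open>Counts are integers, so an outcome with too many failures misses the bound by at
    least 1/3. This uniform gap keeps the expectation strictly below two thirds of
    \<open>card E\<close>.\<close>
  have "X w \<le> (2 * real (card E) - 1) / 3" if w: "w \<in> set_pmf \<mu>" for w
  proof -
    have "card E = card {e\<in>E. R w e} + card {e\<in>E. \<not> R w e}"
      using E by (subst card_Un_disjoint[symmetric]) (auto intro: arg_cong[where f = card])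
    moreover have "card E < 3 * card {e\<in>E. \<not> R w e}" using neg w by (auto simp: not_le)
    ultimately have "3 * card {e\<in>E. R w e} + 1 \<le> 2 * card E" by linarith
    then have "real (3 * card {e\<in>E. R w e} + 1) \<le> real (2 * card E)" by (rule of_nat_mono)
    then show ?thesis by (simp add: X)
  qed
  then have "measure_pmf.expectation \<mu> X \<le> (2 * real (card E) - 1) / 3"
    by (intro measure_pmf.integral_le_const int) (auto simp: AE_measure_pmf_iff)
  moreover have "measure_pmf.expectation \<mu> X = (\<Sum>e\<in>E. measure_pmf.prob \<mu> {w. R w e})"
    unfolding X_def by (subst Bochner_Integration.integral_sum) (auto intro: int)
  moreover have "\<dots> \<ge> (\<Sum>e\<in>E. 2/3)" by (intro sum_mono prob)
  ultimately show False by simp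
qed

text \<open>One decoder serves all edge subsets \<open>H\<close>, while the distribution may depend
  on \<open>H\<close>. The proof covers \<open>Pow E\<close> by balls \<open>N sk\<close>, one for
  each function \<open>sk\<close> in \<open>F\<close>, and compares cardinalities.\<close>

lemma sketch_edge_bound:
  fixes G :: "nat ugraph" and D :: "bool list \<Rightarrow> bool list \<Rightarrow> bool"
  assumes G: "finite_graph G"
    and sketch: "\<And>H. H \<subseteq> edges G \<Longrightarrow> \<exists>\<mu> :: (nat \<Rightarrow> bool list) pmf.
          set_pmf \<mu> \<subseteq> verts G \<rightarrow>\<^sub>E bitstrings c \<and>
          (\<forall>x\<in>verts G. \<forall>y\<in>verts G.
             measure_pmf.prob \<mu> {sk. D (sk x) (sk y) \<longleftrightarrow> adjacent (verts G, H) x y} \<ge> 2/3)"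
  shows "card (edges G) \<le> 13 * c * card (verts G)"
proof -
  define E where "E = edges G"
  define m where "m = card E"
  define n where "n = card (verts G)"
  define F where "F = (verts G \<rightarrow>\<^sub>E bitstrings c)"
  \<comment> \<open>The decoder need not be symmetric, so each edge is queried once, from its
    smaller to its larger endpoint.\<close>
  define A where "A sk = {e\<in>E. D (sk (Min e)) (sk (Max e))}" for sk
  define N where "N sk = {H \<in> Pow E. 3 * card (sym_diff H (A sk)) \<le> card E}" for sk
  have finE: "finite E" using finite_edges[OF G] by (simp add: E_def)
  have finV: "finite (verts G)" using G by (simp add: finite_graph_def)
  have finF: "finite F" unfolding F_def using finV finite_bitstrings by (intro finite_PiE)
  have cardF: "card F = 2 ^ (c * n)"
    using finV by (simp add: F_def card_funcsetE card_bitstrings n_def power_mult)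
  have MinMax: "{Min e, Max e} = e" "Min e \<in> verts G" "Max e \<in> verts G" if e: "e \<in> E" for e
  proof -
    have "e \<subseteq> verts G" "card e = 2" using e G by (auto simp: E_def finite_graph_def)
    then obtain a b where "e = {a, b}" by (auto simp: card_2_iff)
    with \<open>e \<subseteq> verts G\<close> show "{Min e, Max e} = e" "Min e \<in> verts G" "Max e \<in> verts G"
      by (auto simp: min_def max_def)
  qed
  have "Pow E \<subseteq> (\<Union>sk\<in>F. N sk)"
  proof
    fix H assume H: "H \<in> Pow E"
    obtain \<mu> :: "(nat \<Rightarrow> bool list) pmf" where \<mu>: "set_pmf \<mu> \<subseteq> F"
      and prob: "\<And>x y. x \<in> verts G \<Longrightarrow> y \<in> verts G \<Longrightarrow>
        measure_pmf.prob \<mu> {sk. D (sk x) (sk y) \<longleftrightarrow> adjacent (verts G, H) x y} \<ge> 2/3"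
      using sketch[of H] H by (auto simp: E_def F_def)
    have "measure_pmf.prob \<mu> {sk. D (sk (Min e)) (sk (Max e)) \<longleftrightarrow> e \<in> H} \<ge> 2/3" if "e \<in> E" for e
      using prob[OF MinMax(2,3)[OF that]] MinMax(1)[OF that] by (simp add: adjacent_def)
    then obtain sk where "sk \<in> set_pmf \<mu>"
        and le: "3 * card {e\<in>E. \<not> (D (sk (Min e)) (sk (Max e)) \<longleftrightarrow> e \<in> H)} \<le> card E"
      using outcome_with_few_failures[OF finite_subset[OF \<mu> finF] finE,
          of "\<lambda>sk e. D (sk (Min e)) (sk (Max e)) \<longleftrightarrow> e \<in> H"] by blast
    moreover have "{e\<in>E. \<not> (D (sk (Min e)) (sk (Max e)) \<longleftrightarrow> e \<in> H)} = sym_diff H (A sk)"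
      using H by (auto simp: A_def)
    ultimately show "H \<in> (\<Union>sk\<in>F. N sk)" using \<mu> H by (auto simp: N_def)
  qed
  moreover have "finite (\<Union>sk\<in>F. N sk)" using finF finE by (auto simp: N_def)
  ultimately have "card (Pow E) \<le> card (\<Union>sk\<in>F. N sk)" by (rule card_mono[rotated])
  also have "\<dots> \<le> (\<Sum>sk\<in>F. card (N sk))" by (rule card_UN_le[OF finF])
  finally have "2 ^ m \<le> (\<Sum>sk\<in>F. card (N sk))" using finE by (simp add: card_Pow m_def)
  then have "real (2 ^ m) \<le> real (\<Sum>sk\<in>F. card (N sk))" by (rule of_nat_mono)
  then have count: "2 ^ m \<le> (\<Sum>sk\<in>F. real (card (N sk)))" by simp
  define r :: real where "r = root 3 ((27/4) ^ m)"
  have r3: "r ^ 3 = (27/4) ^ m" by (simp add: r_def)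
  have r0: "r \<ge> 0" by (simp add: r_def)
  have "real (card (N sk)) \<le> r" for sk
  proof -
    have "real (card (N sk)) ^ 3 \<le> r ^ 3"
      using card_hamming_ball_third[OF finE, of "A sk"] unfolding r3 by (auto simp: N_def A_def m_def)
    then show ?thesis using power_mono_iff[of "real (card (N sk))" r 3] r0 by simp
  qed
  then have "(2::real) ^ m \<le> 2 ^ (c * n) * r"
    using count sum_mono[of F "\<lambda>sk. real (card (N sk))" "\<lambda>_. r"] cardF by simp
  \<comment> \<open>Cubing removes the root. Since 8 = (32/27) * (27/4), the power of 27/4 then
    cancels.\<close>
  then have "((2::real) ^ m) ^ 3 \<le> (2 ^ (c * n) * r) ^ 3" by (intro power_mono) auto
  also have "\<dots> = 8 ^ (c * n) * (27/4) ^ m"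
    unfolding power_mult_distrib r3 using power_mult[of "2::real" 3 "c * n"]
    by (simp add: mult.commute flip: power_mult)
  also have "((2::real) ^ m) ^ 3 = (32/27) ^ m * (27/4) ^ m"
    using power_mult[of "2::real" 3 m]
    by (simp add: mult.commute flip: power_mult power_mult_distrib)
  finally have "(32/27 :: real) ^ m \<le> 8 ^ (c * n)" by simp
  \<comment> \<open>13 is the least exponent at which a power of 32/27 reaches 8.\<close>
  also have "\<dots> \<le> ((32/27) ^ 13) ^ (c * n)" by (intro power_mono) (simp_all add: power_divide)
  also have "\<dots> = (32/27) ^ (13 * (c * n))" by (simp only: power_mult)
  finally have "m \<le> 13 * (c * n)" by simp
  then show ?thesis by (simp add: m_def E_def n_def mult.assoc)
qed

section \<open>Sparse subgraphs and arboricity\<close>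

lemma sum_degrees:
  assumes "finite_graph G"
  shows "(\<Sum>v\<in>verts G. card (incident G v)) = 2 * card (edges G)"
proof -
  have "{v \<in> verts G. v \<in> e} = e" "card e = 2" if "e \<in> edges G" for e
    using assms that by (auto simp: finite_graph_def)
  then show ?thesis
    unfolding incident_def using assms finite_edges[OF assms]
    by (intro sum_multicount) (auto simp: finite_graph_def)
qed

text \<open>By the degree sum, the average degree is at most \<open>2 * K\<close>.\<close>

lemma low_degree_vertex:
  assumes G: "finite_graph G" "verts G \<noteq> {}" and K: "card (edges G) \<le> K * card (verts G)"
  obtains v where "v \<in> verts G" "card (incident G v) \<le> 2 * K"
proof (rule ccontr)
  assume "\<not> thesis"
  then have "Suc (2 * K) \<le> card (incident G v)" if "v \<in> verts G" for v
    using that \<open>\<And>v. v \<in> verts G \<Longrightarrow> card (incident G v) \<le> 2 * K \<Longrightarrow> thesis\<close> not_less_eq_eq by blast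
  then have "(\<Sum>v\<in>verts G. Suc (2 * K)) \<le> 2 * card (edges G)"
    unfolding sum_degrees[OF G(1), symmetric] by (rule sum_mono)
  moreover have "card (verts G) > 0" using G by (simp add: card_gt_0_iff finite_graph_def)
  ultimately show False using K by (simp add: algebra_simps)
qed

text \<open>The predecessor and the successor on a cycle are distinct because the length is at least
  3.\<close>

lemma cycle_vertex_degree:
  assumes "is_cycle G c" "finite_graph G" "v \<in> set c"
  shows "card (incident G v) \<ge> 2"
proof -
  obtain i where i: "i < length c" "c ! i = v" using assms(3) by (auto simp: in_set_conv_nth)
  let ?n = "length c"
  have n: "?n \<ge> 3" and d: "distinct c"
    and adj: "\<And>i. i < ?n \<Longrightarrow> adjacent G (c ! i) (c ! (Suc i mod ?n))"
    using assms(1) by (auto simp: is_cycle_def)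
  let ?s = "Suc i mod ?n" and ?p = "if i = 0 then ?n - 1 else i - 1"
  have p: "?p < ?n" "Suc ?p mod ?n = i" and s: "?s < ?n" using i n by (auto intro!: mod_less_divisor)
  have "?s \<noteq> ?p" using i n by (cases "Suc i = ?n") auto
  then have ne: "c ! ?s \<noteq> c ! ?p" using d s p by (simp add: nth_eq_iff_index_eq)
  have "{v, c ! ?s} \<in> incident G v" "{v, c ! ?p} \<in> incident G v"
    using adj[OF i(1)] adj[OF p(1)] unfolding p(2) i(2)
    by (auto simp: adjacent_def incident_def insert_commute)
  moreover have "{v, c ! ?s} \<noteq> {v, c ! ?p}" using ne by (auto simp: doubleton_eq_iff)
  ultimately have "card {{v, c ! ?s}, {v, c ! ?p}} \<le> card (incident G v)"
    by (intro card_mono finite_incident assms) auto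
  then show ?thesis using \<open>{v, c ! ?s} \<noteq> {v, c ! ?p}\<close> by simp
qed

text \<open>Delete a vertex \<open>v\<close> of degree at most \<open>d\<close>, colour the rest by
  induction, and give the edges at \<open>v\<close> pairwise distinct colours. Within one colour
  \<open>v\<close> then has degree at most 1, so a monochromatic cycle would avoid \<open>v\<close>
  and already lie in the smaller graph.\<close>

lemma degenerate_forest_colouring:
  fixes G :: "'a ugraph"
  assumes "finite_graph G"
    and "\<And>H. subgraph H G \<Longrightarrow> verts H \<noteq> {} \<Longrightarrow> \<exists>v\<in>verts H. card (incident H v) \<le> d"
  shows "\<exists>f :: 'a set \<Rightarrow> nat. (\<forall>e\<in>edges G. f e < d) \<and>
           (\<forall>i. forest (verts G, {e\<in>edges G. f e = i}))"
  using assms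
proof (induction "card (verts G)" arbitrary: G)
  case 0
  then have "verts G = {}" by (auto simp: finite_graph_def)
  moreover from this have "edges G = {}" using 0(2) by (fastforce simp: finite_graph_def)
  ultimately show ?case by (auto simp: forest_def finite_graph_def is_cycle_def)
next
  case (Suc n)
  note G = \<open>finite_graph G\<close>
  have "verts G \<noteq> {}" using Suc.hyps(2) by auto
  moreover have "subgraph G G" using G by (simp add: subgraph_def)
  ultimately obtain v where v: "v \<in> verts G" "card (incident G v) \<le> d"
    using Suc.prems(2) by blast
  let ?H = "delete_vertex G v"
  have "n = card (verts ?H)"
    using Suc.hyps(2) v(1) G by (simp add: delete_vertex_def finite_graph_def)
  then have "\<exists>f :: 'a set \<Rightarrow> nat. (\<forall>e\<in>edges ?H. f e < d) \<and>
      (\<forall>i. forest (verts ?H, {e\<in>edges ?H. f e = i}))"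
    using Suc.hyps(1)[OF _ finite_graph_delete_vertex[OF G]] Suc.prems(2)
      subgraph_trans[OF _ subgraph_delete_vertex[OF G]] by blast
  then obtain f :: "'a set \<Rightarrow> nat" where fd: "\<And>e. e \<in> edges ?H \<Longrightarrow> f e < d"
    and ff: "\<And>i. forest (verts ?H, {e\<in>edges ?H. f e = i})" by blast
  have "card (incident G v) \<le> card {..<d}" using v(2) by simp
  then obtain g :: "'a set \<Rightarrow> nat" where g: "inj_on g (incident G v)" "g ` incident G v \<subseteq> {..<d}"
    using card_le_inj[OF finite_incident[OF G]] by blast
  define h where "h e = (if v \<in> e then g e else f e)" for e
  have eH: "edges ?H = {e\<in>edges G. v \<notin> e}" by (auto simp: delete_vertex_def incident_def)
  have "h e < d" if "e \<in> edges G" for e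
    using that fd[of e] g(2) unfolding eH by (auto simp: h_def incident_def)
  moreover have "forest (verts G, {e\<in>edges G. h e = i})" (is "forest ?C") for i
  proof -
    have C: "finite_graph ?C" using G by (auto simp: finite_graph_def)
    have "\<not> is_cycle ?C c" for c
    proof
      assume c: "is_cycle ?C c"
      have "a = b" if "a \<in> incident ?C v" "b \<in> incident ?C v" for a b
        using that g(1) by (auto simp: incident_def h_def inj_on_def)
      then have "card (incident ?C v) \<le> Suc 0"
        unfolding card_le_Suc0_iff_eq[OF finite_incident[OF C]] by blast
      then have vc: "v \<notin> set c" using cycle_vertex_degree[OF c C, of v] by linarith
      have "is_cycle (verts ?H, {e\<in>edges ?H. f e = i}) c"
        unfolding is_cycle_def
      proof (intro conjI allI impI)
        show "3 \<le> length c" "distinct c" using c by (auto simp: is_cycle_def)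
        show "set c \<subseteq> verts (verts ?H, {e\<in>edges ?H. f e = i})"
          using c vc by (auto simp: is_cycle_def delete_vertex_def)
        fix j assume j: "j < length c"
        then have "Suc j mod length c < length c" by (intro mod_less_divisor) linarith
        then have "c ! j \<noteq> v" "c ! (Suc j mod length c) \<noteq> v" using vc j by (metis nth_mem)+
        moreover have "adjacent ?C (c ! j) (c ! (Suc j mod length c))"
          using c j by (simp add: is_cycle_def)
        ultimately show "adjacent (verts ?H, {e\<in>edges ?H. f e = i}) (c ! j) (c ! (Suc j mod length c))"
          unfolding eH by (auto simp: adjacent_def h_def)
      qed
      then show False using ff[of i] by (auto simp: forest_def)
    qed
    then show ?thesis using C by (simp add: forest_def)
  qed
  ultimately show ?case by blast
qed

lemma arboricity_le_of_colouring:
  fixes f :: "'a set \<Rightarrow> nat"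
  assumes "\<And>e. e \<in> edges G \<Longrightarrow> f e < d" and "\<And>i. forest (verts G, {e\<in>edges G. f e = i})"
  shows "arboricity G \<le> d"
proof -
  let ?C = "\<lambda>i. {e\<in>edges G. f e = i}"
  let ?P = "?C ` {..<d} - {{}}"
  have "forest_partition G ?P"
    using assms by (auto simp: forest_partition_def partition_on_def disjoint_def)
  then have "arboricity G \<le> card ?P" unfolding arboricity_def by (intro Least_le) blast
  also have "\<dots> \<le> card (?C ` {..<d})" by (intro card_mono) auto
  also have "\<dots> \<le> d" using card_image_le[of "{..<d}" ?C] by simp
  finally show ?thesis .
qed

text \<open>Closure under subgraphs enters twice: spanning subgraphs give the edge bound for each
  member, and arbitrary subgraphs inherit that bound, which yields degeneracy.\<close>

lemma bounded_arboricity_of_sketchable: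
  assumes mono: "monotone_class \<F>" and sk: "adjacency_sketchable \<F>"
  shows "bounded_arboricity \<F>"
proof -
  obtain c and D :: "bool list \<Rightarrow> bool list \<Rightarrow> bool" where D: "\<And>G. G \<in> \<F> \<Longrightarrow>
      \<exists>\<mu> :: (nat \<Rightarrow> bool list) pmf. set_pmf \<mu> \<subseteq> verts G \<rightarrow>\<^sub>E bitstrings c \<and>
          (\<forall>x\<in>verts G. \<forall>y\<in>verts G.
             measure_pmf.prob \<mu> {sk. D (sk x) (sk y) \<longleftrightarrow> adjacent G x y} \<ge> 2/3)"
    using sk unfolding adjacency_sketchable_def admits_adjacency_sketch_def by blast
  have fin: "finite_graph G" if "G \<in> \<F>" for G
    using mono that by (auto simp: monotone_class_def graph_class_def)
  have sub: "H \<in> \<F>" if "G \<in> \<F>" "subgraph H G" for G H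
    using mono that unfolding monotone_class_def by blast
  have edges: "card (edges G) \<le> 13 * c * card (verts G)" if G: "G \<in> \<F>" for G
  proof (rule sketch_edge_bound[OF fin[OF G], where D = D])
    fix H assume "H \<subseteq> edges G"
    then have "subgraph (verts G, H) G" using fin[OF G] by (auto simp: subgraph_def finite_graph_def)
    from D[OF sub[OF G this]] show "\<exists>\<mu> :: (nat \<Rightarrow> bool list) pmf.
          set_pmf \<mu> \<subseteq> verts G \<rightarrow>\<^sub>E bitstrings c \<and>
          (\<forall>x\<in>verts G. \<forall>y\<in>verts G.
             measure_pmf.prob \<mu> {sk. D (sk x) (sk y) \<longleftrightarrow> adjacent (verts G, H) x y} \<ge> 2/3)"
      by simp
  qed
  have "arboricity G \<le> 2 * (13 * c)" if G: "G \<in> \<F>" for G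
  proof -
    have "\<exists>v\<in>verts H. card (incident H v) \<le> 2 * (13 * c)" if "subgraph H G" "verts H \<noteq> {}" for H
      using low_degree_vertex[OF fin that(2) edges] sub[OF G that(1)] by metis
    from degenerate_forest_colouring[OF fin[OF G] this] show ?thesis
      using arboricity_le_of_colouring by blast
  qed
  then show ?thesis unfolding bounded_arboricity_def by blast
qed

theorem theorem3p1:
  fixes \<F> :: "nat ugraph set"
  assumes "monotone_class \<F>"
  shows "(adjacency_sketchable \<F> \<longleftrightarrow> (\<exists>s k. disjunctive_scheme \<F> s k)) \<and>
         ((\<exists>s k. disjunctive_scheme \<F> s k) \<longleftrightarrow> bounded_arboricity \<F>)"
proof -
  have fin: "finite_graph G" if "G \<in> \<F>" for G
    using assms that by (auto simp: monotone_class_def graph_class_def)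
  have "\<exists>s k. disjunctive_scheme \<F> s k" if "bounded_arboricity \<F>"
    using that disjunctive_scheme_of_bounded_arboricity[OF fin]
    unfolding bounded_arboricity_def by blast
  moreover have "adjacency_sketchable \<F>" if "\<exists>s k. disjunctive_scheme \<F> s k"
    using that sketchable_of_disjunctive_scheme[OF fin] by blast
  moreover note bounded_arboricity_of_sketchable[OF assms]
  ultimately show ?thesis by blast
qed

end
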